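(* Let $L>0$, $0<L_1\le L$, $1<\alpha\le 2$, let $\nu,d$ be real constants, and let $c(x,t)$ be a solution of $$\frac{\partial c(x,t)}{\partial t}=-\nu\frac{\partial c(x,t)}{\partial x}+d\,\frac{\partial^\alpha c(x,t)}{\partial x^\alpha}+r(x,t),\qquad 0<x<L,\ t>0,$$ with $c(x,0)=g_0(x)$ and $c(0,t)=c(L,t)=0$, where $r$ is the source term, $g_0$ is the initial datum, and $\partial^\alpha/\partial x^\alpha$ is the Riemann-Liouville derivative of order $\alpha$ in $x$. Let $p$ be the positive integer with $p-1\le\alpha<p$, let $N\ge 2$, and let $\phi_1,\dots,\phi_N$ be modulating functions of order $p$ on $[0,L_1]$. Then for every $t>0$ the parameters $\nu$ and $d$ are given by the solution of the following linear system, i.e. they satisfy $$\begin{pmatrix} A_1 & B_1 \\ {} A_2 & B_2 \\ {} \vdots & \vdots \\ {} A_N & B_N \end{pmatrix}\begin{pmatrix} -\nu \\ {} d \end{pmatrix}=\begin{pmatrix} C_1 \\ {} C_2 \\ {} \vdots \\ {} C_N \end{pmatrix},$$ where, for $n=1,\dots,N$, $$A_n=\int_0^{L_1}\phi_n'(L_1-x)\,c(x,t)\,dx,\qquad B_n=\int_0^{L_1}\frac{\partial^\alpha\phi_n(x)}{\partial x^\alpha}\,c(L_1-x,t)\,dx,$$ $$C_n=\int_0^{L_1}\Big[\phi_n(L_1-x)\frac{\partial c(x,t)}{\partial t}-r(x,t)\,\phi_n(L_1-x)\Big]dx.$$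
   Context: Riemann-Liouville derivative: for $p-1\le\alpha<p$ with $p$ a positive integer, $\dfrac{\partial^\alpha f(x)}{\partial x^\alpha}=D_x^\alpha f(x)=\dfrac{1}{\Gamma(p-\alpha)}\dfrac{d^p}{dx^p}\displaystyle\int_0^x(x-\tau)^{p-\alpha-1}f(\tau)\,d\tau$; for a function $c(x,t)$ it is taken in $x$ with $t$ fixed. Modulating function: a function $\phi\in C^k([a,b])$ is a modulating function of order $k\ge 1$ on $[a,b]$ if $\phi^{(i)}(a)=\phi^{(i)}(b)=0$ for $i=0,1,\dots,k-1$. Regularity convention: $c$ is regular enough for all terms of the equation and all integrals to make sense. Concretely, for each $t>0$: $c(\cdot,t)$ is absolutely continuous on $[0,L]$; the fractional integral $x\mapsto\frac1{\Gamma(p-\alpha)}\int_0^x(x-\tau)^{p-\alpha-1}c(\tau,t)\,d\tau$ has $p-1$ derivatives on $[0,L]$, the $(p-1)$-st being absolutely continuous; $\partial c/\partial t(\cdot,t)$ and $r(\cdot,t)$ are integrable on $(0,L)$; and the equation holds for almost every $x\in(0,L)$. *)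

theory Defs
  imports "HOL-Analysis.Analysis"
begin

(* One-sided at the end points when S is a nondegenerate closed interval, so that values
   outside S play no role. *)
primrec nth_deriv_on :: "real set \<Rightarrow> nat \<Rightarrow> (real \<Rightarrow> real) \<Rightarrow> real \<Rightarrow> real" where
  "nth_deriv_on S 0 f = f"
| "nth_deriv_on S (Suc k) f = (\<lambda>x. vector_derivative (nth_deriv_on S k f) (at x within S))"

definition times_differentiable_on :: "nat \<Rightarrow> real set \<Rightarrow> (real \<Rightarrow> real) \<Rightarrow> bool" where
  "times_differentiable_on k S f \<longleftrightarrow> (\<forall>i<k. nth_deriv_on S i f differentiable_on S)"

definition Ck_on :: "nat \<Rightarrow> real set \<Rightarrow> (real \<Rightarrow> real) \<Rightarrow> bool" where
  "Ck_on k S f \<longleftrightarrow> times_differentiable_on k S f \<and> continuous_on S (nth_deriv_on S k f)"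

definition modulating_function :: "nat \<Rightarrow> real \<Rightarrow> real \<Rightarrow> (real \<Rightarrow> real) \<Rightarrow> bool" where
  "modulating_function k a b \<phi> \<longleftrightarrow>
     k \<ge> 1 \<and> Ck_on k {a..b} \<phi> \<and>
     (\<forall>i<k. nth_deriv_on {a..b} i \<phi> a = 0 \<and> nth_deriv_on {a..b} i \<phi> b = 0)"

(* The usual epsilon-delta notion. A division D is a finite family of nondegenerate or
   degenerate closed intervals {u..v} with disjoint interiors; Inf K, Sup K are u and v. *)
definition abs_continuous_on :: "real \<Rightarrow> real \<Rightarrow> (real \<Rightarrow> real) \<Rightarrow> bool" where
  "abs_continuous_on a b f \<longleftrightarrow>
     (\<forall>\<epsilon>>0. \<exists>\<delta>>0. \<forall>D. D division_of \<Union>D \<longrightarrow> \<Union>D \<subseteq> {a..b} \<longrightarrow> (\<Sum>K\<in>D. Sup K - Inf K) < \<delta> \<longrightarrow>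
        (\<Sum>K\<in>D. \<bar>f (Sup K) - f (Inf K)\<bar>) < \<epsilon>)"

(* The integer p with p - 1 \<le> \<alpha> < p; note that p = 3 for \<alpha> = 2. *)
definition rl_order :: "real \<Rightarrow> nat" where
  "rl_order \<alpha> = nat \<lfloor>\<alpha>\<rfloor> + 1"

lemma rl_order_iff:
  assumes "\<alpha> \<ge> 0"
  shows "rl_order \<alpha> = p \<longleftrightarrow> 0 < p \<and> real p - 1 \<le> \<alpha> \<and> \<alpha> < real p"
  using assms unfolding rl_order_def by (auto; linarith)

definition rl_kernel_integral :: "real \<Rightarrow> (real \<Rightarrow> real) \<Rightarrow> real \<Rightarrow> real" where
  "rl_kernel_integral \<beta> f x = (LINT \<tau>:{0..x}|lebesgue. (x - \<tau>) powr (\<beta> - 1) * f \<tau>)"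

definition rl_integral :: "real \<Rightarrow> (real \<Rightarrow> real) \<Rightarrow> real \<Rightarrow> real" where
  "rl_integral \<beta> f x = 1 / Gamma \<beta> * rl_kernel_integral \<beta> f x"

(* deriv is two-sided: meaningful at interior points of the domain of f only, which is
   where it is used (up to null sets). *)
definition rl_derivative :: "real \<Rightarrow> (real \<Rightarrow> real) \<Rightarrow> real \<Rightarrow> real" where
  "rl_derivative \<alpha> f x =
     1 / Gamma (real (rl_order \<alpha>) - \<alpha>) *
     (deriv ^^ rl_order \<alpha>) (rl_kernel_integral (real (rl_order \<alpha>) - \<alpha>) f) x"

(* Existence of the outermost of the derivatives in rl_derivative; below, the inner ones
   exist by the regularity convention. *)
definition rl_differentiable_at :: "real \<Rightarrow> (real \<Rightarrow> real) \<Rightarrow> real \<Rightarrow> bool" where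
  "rl_differentiable_at \<alpha> f x \<longleftrightarrow>
     (deriv ^^ (rl_order \<alpha> - 1)) (rl_kernel_integral (real (rl_order \<alpha>) - \<alpha>) f) differentiable (at x)"

definition regular_enough ::
  "real \<Rightarrow> real \<Rightarrow> (real \<Rightarrow> real \<Rightarrow> real) \<Rightarrow> (real \<Rightarrow> real \<Rightarrow> real) \<Rightarrow> bool" where
  "regular_enough L \<alpha> r c \<longleftrightarrow> (\<forall>t>0.
     abs_continuous_on 0 L (\<lambda>x. c x t) \<and>
     times_differentiable_on (rl_order \<alpha> - 1) {0..L}
       (rl_integral (real (rl_order \<alpha>) - \<alpha>) (\<lambda>x. c x t)) \<and>
     abs_continuous_on 0 L (nth_deriv_on {0..L} (rl_order \<alpha> - 1)
       (rl_integral (real (rl_order \<alpha>) - \<alpha>) (\<lambda>x. c x t))) \<and>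
     set_integrable lebesgue {0<..<L} (\<lambda>x. deriv (\<lambda>s. c x s) t) \<and>
     set_integrable lebesgue {0<..<L} (\<lambda>x. r x t))"

(* deriv is total, so the equation at (x, t) is read as "every term exists and the equality
   holds". Almost everywhere, existence of the two terms in x follows from absolute
   continuity (Lebesgue's theorem); only that of the time derivative is a genuine demand. *)
definition equation_holds_at ::
  "real \<Rightarrow> real \<Rightarrow> real \<Rightarrow> (real \<Rightarrow> real \<Rightarrow> real) \<Rightarrow> (real \<Rightarrow> real \<Rightarrow> real) \<Rightarrow> real \<Rightarrow> real \<Rightarrow> bool" where
  "equation_holds_at \<alpha> \<nu> d r c x t \<longleftrightarrow>
     (\<lambda>s. c x s) differentiable (at t) \<and>
     (\<lambda>y. c y t) differentiable (at x) \<and>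
     rl_differentiable_at \<alpha> (\<lambda>y. c y t) x \<and>
     deriv (\<lambda>s. c x s) t =
       - \<nu> * deriv (\<lambda>y. c y t) x + d * rl_derivative \<alpha> (\<lambda>y. c y t) x + r x t"

definition solution ::
  "real \<Rightarrow> real \<Rightarrow> real \<Rightarrow> real \<Rightarrow> (real \<Rightarrow> real \<Rightarrow> real) \<Rightarrow> (real \<Rightarrow> real) \<Rightarrow> (real \<Rightarrow> real \<Rightarrow> real) \<Rightarrow> bool" where
  "solution L \<alpha> \<nu> d r g\<^sub>0 c \<longleftrightarrow>
     regular_enough L \<alpha> r c \<and>
     (\<forall>t>0. AE x\<in>{0<..<L} in lebesgue. equation_holds_at \<alpha> \<nu> d r c x t) \<and>
     (\<forall>x\<in>{0<..<L}. c x 0 = g\<^sub>0 x) \<and>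
     (\<forall>t>0. c 0 t = 0 \<and> c L t = 0)"

definition coeff_A :: "real \<Rightarrow> (real \<Rightarrow> real) \<Rightarrow> (real \<Rightarrow> real \<Rightarrow> real) \<Rightarrow> real \<Rightarrow> real" where
  "coeff_A L\<^sub>1 \<phi> c t = (LINT x:{0..L\<^sub>1}|lebesgue. deriv \<phi> (L\<^sub>1 - x) * c x t)"

definition coeff_B :: "real \<Rightarrow> real \<Rightarrow> (real \<Rightarrow> real) \<Rightarrow> (real \<Rightarrow> real \<Rightarrow> real) \<Rightarrow> real \<Rightarrow> real" where
  "coeff_B L\<^sub>1 \<alpha> \<phi> c t = (LINT x:{0..L\<^sub>1}|lebesgue. rl_derivative \<alpha> \<phi> x * c (L\<^sub>1 - x) t)"

definition coeff_C ::
  "real \<Rightarrow> (real \<Rightarrow> real) \<Rightarrow> (real \<Rightarrow> real \<Rightarrow> real) \<Rightarrow> (real \<Rightarrow> real \<Rightarrow> real) \<Rightarrow> real \<Rightarrow> real" where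
  "coeff_C L\<^sub>1 \<phi> r c t =
     (LINT x:{0..L\<^sub>1}|lebesgue. \<phi> (L\<^sub>1 - x) * deriv (\<lambda>s. c x s) t - r x t * \<phi> (L\<^sub>1 - x))"

end

theory Submission
  imports Defs
begin

text \<open>Multiply the equation by \<open>\<phi> (L\<^sub>1 - x)\<close> and integrate over \<open>[0, L\<^sub>1]\<close>. Integration by parts moves
  all derivatives from \<open>c\<close> and from its fractional integral onto \<open>\<phi>\<close>; the boundary terms vanish because
  \<open>\<phi>\<close> is modulating. Up to the factor \<open>1 / \<Gamma> (p - \<alpha>)\<close> this leaves
  \<open>\<integral> (k * c)(x) \<phi>\<^sup>p (L\<^sub>1 - x) dx\<close> with the power kernel \<open>k\<close> and the \<open>p\<close>-th derivative \<open>\<phi>\<^sup>p\<close>, which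
  by Fubini equals \<open>\<integral> (k * \<phi>\<^sup>p)(x) c (L\<^sub>1 - x) dx\<close>, and \<open>k * \<phi>\<^sup>p\<close> is the \<open>p\<close>-th derivative of
  \<open>k * \<phi>\<close> because the lower derivatives of \<open>\<phi>\<close> vanish at \<open>0\<close>. The first integration by parts
  involves functions that are only absolutely continuous; it is carried out in the Henstock-Kurzweil
  sense, so that integrability of the single terms of the equation is never needed.\<close>

section \<open>Absolutely continuous functions\<close>

text \<open>Members of a division overlap only in null sets, so their lengths add up to the measure
  of the union; monotonicity does the rest. This turns a cover of small measure into the length
  bound that absolute continuity asks for.\<close>

lemma sum_length_division_le:
  fixes D :: "real set set"
  assumes D: "D division_of \<Union>D" and sub: "\<Union>D \<subseteq> U" and U: "U \<in> lmeasurable"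
  shows "(\<Sum>K\<in>D. Sup K - Inf K) \<le> measure lebesgue U"
proof -
  note d = division_ofD[OF D]
  have len: "Sup K - Inf K = measure lebesgue K" if K: "K \<in> D" for K
  proof -
    obtain u v where "K = cbox u v" using d(4) K by blast
    moreover have "K \<noteq> {}" using d(3) K by blast
    ultimately show ?thesis by (auto simp: interval_bounds_real)
  qed
  have "(\<Sum>K\<in>D. Sup K - Inf K) = (\<Sum>K\<in>D. measure lebesgue K)"
    by (rule sum.cong[OF refl len])
  also have "\<dots> = measure lebesgue (\<Union>D)"
    using content_division[OF D] by simp
  also have "\<dots> \<le> measure lebesgue U"
    using lmeasurable_division[OF D] by (intro measure_mono_fmeasurable sub U fmeasurableD)
  finally show ?thesis .
qed

section \<open>Continuity and products of absolutely continuous functions\<close>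

lemma abs_continuous_onE:
  assumes "abs_continuous_on a b f" "\<epsilon> > 0"
  obtains \<delta> where "\<delta> > 0"
    "\<And>D. D division_of \<Union>D \<Longrightarrow> \<Union>D \<subseteq> {a..b} \<Longrightarrow> (\<Sum>K\<in>D. Sup K - Inf K) < \<delta> \<Longrightarrow>
        (\<Sum>K\<in>D. \<bar>f (Sup K) - f (Inf K)\<bar>) < \<epsilon>"
  using assms unfolding abs_continuous_on_def by blast

lemma abs_continuous_imp_continuous_on:
  assumes "abs_continuous_on a b f"
  shows "continuous_on {a..b} f"
  unfolding continuous_on_iff
proof (intro ballI allI impI)
  fix x e :: real assume x: "x \<in> {a..b}" and e: "0 < e"
  obtain \<delta> where \<delta>: "\<delta> > 0" and
    *: "\<And>D. D division_of \<Union>D \<Longrightarrow> \<Union>D \<subseteq> {a..b} \<Longrightarrow> (\<Sum>K\<in>D. Sup K - Inf K) < \<delta> \<Longrightarrow>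
        (\<Sum>K\<in>D. \<bar>f (Sup K) - f (Inf K)\<bar>) < e"
    by (rule abs_continuous_onE[OF assms e]) blast
  have "dist (f y) (f x) < e" if y: "y \<in> {a..b}" "dist y x < \<delta>" for y
  proof -
    define u v where "u = min x y" and "v = max x y"
    have uv: "u \<le> v" "v - u < \<delta>" "{u..v} \<subseteq> {a..b}"
      using x y by (auto simp: u_def v_def dist_real_def)
    \<comment> \<open>A single interval is already a division, so the definition specialises to
      uniform continuity.\<close>
    have "{{u..v}} division_of \<Union>{{u..v}}"
      using uv division_of_self[of u v] by (simp add: box_real)
    from *[OF this] uv have "\<bar>f v - f u\<bar> < e" by simp
    then show ?thesis by (auto simp: u_def v_def dist_real_def min_def max_def split: if_splits)
  qed
  then show "\<exists>d>0. \<forall>x'\<in>{a..b}. dist x' x < d \<longrightarrow> dist (f x') (f x) < e"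
    using \<delta> by blast
qed

lemma abs_continuous_on_subinterval:
  assumes "abs_continuous_on a b f" "{c..d} \<subseteq> {a..b}"
  shows "abs_continuous_on c d f"
  using assms unfolding abs_continuous_on_def by (meson order_trans)

text \<open>Over \<open>{u..v}\<close> the increment of the product is
  \<open>g v * (f v - f u) + f u * (g v - g u)\<close>. Absolute continuity of \<open>f\<close> and
  boundedness of \<open>g\<close> control the first term; the second is at most proportional to the
  length of the interval.\<close>

lemma abs_continuous_on_mult_lipschitz:
  assumes f: "abs_continuous_on a b f" and g: "B-lipschitz_on {a..b} g"
  shows "abs_continuous_on a b (\<lambda>x. f x * g x)"
  unfolding abs_continuous_on_def
proof (intro allI impI)
  fix e :: real assume e: "0 < e"
  have cf: "continuous_on {a..b} f" by (rule abs_continuous_imp_continuous_on[OF f])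
  have cg: "continuous_on {a..b} g" by (rule lipschitz_on_continuous_on[OF g])
  obtain M where M: "M > 0" "\<And>x. x \<in> {a..b} \<Longrightarrow> \<bar>f x\<bar> \<le> M"
    using compact_imp_bounded[OF compact_continuous_image[OF cf compact_Icc]]
    unfolding bounded_pos by auto
  obtain M' where M': "M' > 0" "\<And>x. x \<in> {a..b} \<Longrightarrow> \<bar>g x\<bar> \<le> M'"
    using compact_imp_bounded[OF compact_continuous_image[OF cg compact_Icc]]
    unfolding bounded_pos by auto
  have B: "B \<ge> 0" by (rule lipschitz_on_nonneg[OF g])
  have e1: "e / (2 * M') > 0" using e M' by simp
  obtain \<delta> where \<delta>: "\<delta> > 0" and
    *: "\<And>D. D division_of \<Union>D \<Longrightarrow> \<Union>D \<subseteq> {a..b} \<Longrightarrow> (\<Sum>K\<in>D. Sup K - Inf K) < \<delta> \<Longrightarrow>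
        (\<Sum>K\<in>D. \<bar>f (Sup K) - f (Inf K)\<bar>) < e / (2 * M')"
    by (rule abs_continuous_onE[OF f e1]) blast
  \<comment> \<open>The second entry keeps the Lipschitz contribution, \<open>M * B\<close> times
    the total length, at or below \<open>e / 2\<close>; \<open>B + 1\<close> avoids a zero
    denominator for \<open>B = 0\<close>.\<close>
  define \<delta>' where "\<delta>' = min \<delta> (e / (2 * M * (B + 1)))"
  have MB: "2 * M * (B + 1) > 0" using M B by simp
  have "(\<Sum>K\<in>D. \<bar>f (Sup K) * g (Sup K) - f (Inf K) * g (Inf K)\<bar>) < e"
    if D: "D division_of \<Union>D" "\<Union>D \<subseteq> {a..b}" "(\<Sum>K\<in>D. Sup K - Inf K) < \<delta>'" for D
  proof -
    have "\<bar>f (Sup K) * g (Sup K) - f (Inf K) * g (Inf K)\<bar>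
        \<le> M' * \<bar>f (Sup K) - f (Inf K)\<bar> + M * B * (Sup K - Inf K)" if K: "K \<in> D" for K
    proof -
      obtain u v where uv: "K = {u..v}" using division_ofD(4)[OF D(1) K] by auto
      have "K \<noteq> {}" using division_ofD(3)[OF D(1) K] .
      then have le: "u \<le> v" using uv by auto
      have "{u..v} \<subseteq> {a..b}" using D(2) K uv by blast
      then have m: "u \<in> {a..b}" "v \<in> {a..b}" using le by auto
      have "\<bar>f v * g v - f u * g u\<bar> = \<bar>g v * (f v - f u) + f u * (g v - g u)\<bar>"
        by (simp add: algebra_simps)
      also have "\<dots> \<le> \<bar>g v\<bar> * \<bar>f v - f u\<bar> + \<bar>f u\<bar> * \<bar>g v - g u\<bar>"
        by (metis abs_mult abs_triangle_ineq)
      also have "\<dots> \<le> M' * \<bar>f v - f u\<bar> + M * (B * (v - u))"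
        using M'(2)[OF m(2)] M(2)[OF m(1)] M(1) lipschitz_onD[OF g m(2) m(1)] le
        by (intro add_mono mult_mono) (auto simp: dist_real_def)
      finally show ?thesis using uv le by (simp add: algebra_simps)
    qed
    then have "(\<Sum>K\<in>D. \<bar>f (Sup K) * g (Sup K) - f (Inf K) * g (Inf K)\<bar>)
        \<le> (\<Sum>K\<in>D. M' * \<bar>f (Sup K) - f (Inf K)\<bar> + M * B * (Sup K - Inf K))"
      by (rule sum_mono)
    also have "\<dots> = M' * (\<Sum>K\<in>D. \<bar>f (Sup K) - f (Inf K)\<bar>) + M * B * (\<Sum>K\<in>D. Sup K - Inf K)"
      by (simp only: sum.distrib sum_distrib_left)
    also have "\<dots> < M' * (e / (2 * M')) + M * B * (\<Sum>K\<in>D. Sup K - Inf K)"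
      using *[of D] D M'(1) by (intro add_strict_right_mono mult_strict_left_mono) (auto simp: \<delta>'_def)
    also have "\<dots> \<le> e / 2 + M * B * (e / (2 * M * (B + 1)))"
      using M M' B D(3) by (intro add_mono mult_left_mono) (auto simp: \<delta>'_def)
    also have "\<dots> \<le> e / 2 + e / 2"
    proof -
      have "M * B * (e / (2 * M * (B + 1))) = e / 2 * (B / (B + 1))"
        using M(1) B by (simp add: divide_simps)
      also have "\<dots> \<le> e / 2 * 1"
        using e B by (intro mult_left_mono) auto
      finally show ?thesis by simp
    qed
    finally show ?thesis by simp
  qed
  moreover have "\<delta>' > 0" using \<delta> e MB by (simp add: \<delta>'_def)
  ultimately show "\<exists>\<delta>>0. \<forall>D. D division_of \<Union>D \<longrightarrow> \<Union>D \<subseteq> {a..b} \<longrightarrow> (\<Sum>K\<in>D. Sup K - Inf K) < \<delta> \<longrightarrow>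
        (\<Sum>K\<in>D. \<bar>f (Sup K) * g (Sup K) - f (Inf K) * g (Inf K)\<bar>) < e"
    by blast
qed

text \<open>Off the null set the straddle estimate controls a fine Riemann sum as in the classical
  fundamental theorem; the intervals tagged in the null set lie in an open set of small measure,
  where absolute continuity bounds the total increment.\<close>

theorem fundamental_theorem_of_calculus_abs_continuous:
  assumes ab: "a \<le> b" and f: "abs_continuous_on a b f" and N: "negligible N"
    and vecd: "\<And>x. x \<in> {a..b} - N \<Longrightarrow> (f has_vector_derivative f' x) (at x within {a..b})"
  shows "(f' has_integral f b - f a) {a..b}"
proof -
  \<comment> \<open>Intervals tagged in \<open>N\<close> then contribute only the increment of
    \<open>f\<close> to the error; a spike at the end returns from \<open>g\<close> to
    \<open>f'\<close>.\<close>
  define g where "g x = (if x \<in> N then 0 else f' x)" for x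
  have "(g has_integral f b - f a) {a..b}"
    unfolding has_integral[unfolded box_real] box_real(2)[symmetric]
  proof (intro allI impI)
    fix e :: real assume e0: "0 < e"
    \<comment> \<open>The straddle errors sum up to at most \<open>e' * (b - a) \<le> e / 2\<close>;
      the added 1 covers \<open>a = b\<close>.\<close>
    define e' where "e' = e / (2 * (b - a + 1))"
    have e': "e' > 0" using e0 ab by (simp add: e'_def)
    have "\<forall>x. \<exists>d>0. x \<in> {a..b} - N \<longrightarrow>
         (\<forall>y\<in>{a..b}. norm (y-x) < d \<longrightarrow> norm (f y - f x - (y-x) *\<^sub>R f' x) \<le> e' * norm (y-x))"
      using vecd[unfolded has_vector_derivative_def has_derivative_within_alt] e' by blast
    then obtain d where d0: "\<And>x. 0 < d x"
      and d: "\<And>x y. \<lbrakk>x \<in> {a..b} - N; y \<in> {a..b}; norm (y-x) < d x\<rbrakk>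
                        \<Longrightarrow> norm (f y - f x - (y-x) *\<^sub>R f' x) \<le> e' * norm (y-x)"
      by metis
    obtain \<delta> where \<delta>: "\<delta> > 0" and
      ac: "\<And>D. D division_of \<Union>D \<Longrightarrow> \<Union>D \<subseteq> {a..b} \<Longrightarrow> (\<Sum>K\<in>D. Sup K - Inf K) < \<delta> \<Longrightarrow>
          (\<Sum>K\<in>D. \<bar>f (Sup K) - f (Inf K)\<bar>) < e / 2"
      by (rule abs_continuous_onE[OF f half_gt_zero[OF e0]]) blast
    have Nn: "N \<in> null_sets lebesgue" using N by (simp add: negligible_iff_null_sets)
    obtain U where U: "open U" "N \<subseteq> U" "U - N \<in> lmeasurable" "emeasure lebesgue (U - N) < ennreal \<delta>"
      using sets_lebesgue_outer_open[of N \<delta>] Nn \<delta> by (metis null_setsD2)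
    have Um: "U \<in> lmeasurable"
    proof -
      have "N \<in> lmeasurable" using N by (simp add: negligible_iff_measure)
      then have "(U - N) \<union> N \<in> lmeasurable" using U(3) by blast
      moreover have "(U - N) \<union> N = U" using U(2) by blast
      ultimately show ?thesis by simp
    qed
    have mU: "measure lebesgue U < \<delta>"
    proof -
      have "emeasure lebesgue U = emeasure lebesgue (U - N)"
        using emeasure_Diff_null_set[OF Nn] Um by (simp add: fmeasurableD)
      then have "emeasure lebesgue U < ennreal \<delta>" using U(4) by simp
      then show ?thesis using \<delta> Um by (simp add: emeasure_eq_measure2 ennreal_less_iff)
    qed
    define \<gamma> where "\<gamma> x = (if x \<in> N then U else ball x (d x))" for x
    have gauge: "gauge \<gamma>" using U d0 by (auto simp: gauge_def \<gamma>_def)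
    have est: "norm ((\<Sum>(x, K)\<in>p. measure lborel K *\<^sub>R g x) - (f b - f a)) < e"
      if p: "p tagged_division_of cbox a b" and fine: "\<gamma> fine p" for p
    proof -
      have fb: "f b - f a = (\<Sum>(x,K)\<in>p. f(Sup K) - f(Inf K))"
           and ba: "b - a = (\<Sum>(x,K)\<in>p. Sup K - Inf K)"
        using additive_tagged_division_1[where f= "\<lambda>x. x"] additive_tagged_division_1[where f= f]
            ab p by auto
      note pD = tagged_division_ofD[OF p]
      have fin: "finite p" by (rule pD(1))
      define q where "q = {z \<in> p. fst z \<in> N}"
      have "p tagged_partial_division_of cbox a b"
        using p by (simp add: tagged_division_of_def)
      then have "q tagged_partial_division_of cbox a b"
        by (rule tagged_partial_division_subset) (simp add: q_def)
      then have q: "q tagged_division_of \<Union>(snd ` q)"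
        by (rule tagged_partial_division_of_Union_self)
      have qdiv: "snd ` q division_of \<Union>(snd ` q)"
        by (rule division_of_tagged_division[OF q])
      have bad: "(\<Sum>(x,K)\<in>q. \<bar>f (Sup K) - f (Inf K)\<bar>) < e / 2"
      proof -
        \<comment> \<open>A degenerate interval may carry several tags, so passing from tagged pairs
          to intervals requires a summand that vanishes on every \<open>cbox u v\<close> with empty
          interior. The explicit zero handles the empty set, where \<open>Sup\<close> and
          \<open>Inf\<close> carry no information.\<close>
        define h where "h K = (if K = {} then 0 else \<bar>f (Sup K) - f (Inf K)\<bar>)" for K
        have ne: "K \<noteq> {}" if "(x, K) \<in> q" for x K
          using pD(2) that by (fastforce simp: q_def)
        have "(\<Sum>(x,K)\<in>q. \<bar>f (Sup K) - f (Inf K)\<bar>) = (\<Sum>(x,K)\<in>q. h K)"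
          using ne by (intro sum.cong refl) (auto simp: h_def)
        also have "\<dots> = (\<Sum>K\<in>snd ` q. h K)"
        proof (rule sum.over_tagged_division_lemma[OF q])
          fix u v :: real assume "box u v = {}"
          then have "v \<le> u" by simp
          then have "u = v \<or> cbox u v = {}" by auto
          then show "h (cbox u v) = 0" by (auto simp: h_def)
        qed
        also have "\<dots> = (\<Sum>K\<in>snd ` q. \<bar>f (Sup K) - f (Inf K)\<bar>)"
          using ne by (intro sum.cong refl) (auto simp: h_def)
        also have "\<dots> < e / 2"
        proof (rule ac[OF qdiv])
          show "\<Union>(snd ` q) \<subseteq> {a..b}" using pD(3) by (fastforce simp: q_def)
          have "\<Union>(snd ` q) \<subseteq> U" using fine by (fastforce simp: q_def fine_def \<gamma>_def)
          then show "(\<Sum>K\<in>snd ` q. Sup K - Inf K) < \<delta>"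
            using sum_length_division_le[OF qdiv _ Um] mU by linarith
        qed
        finally show ?thesis .
      qed
      have good: "norm (measure lborel K *\<^sub>R g x - (f (Sup K) - f (Inf K))) \<le> e' * (Sup K - Inf K)"
        if xK: "(x, K) \<in> p" "x \<notin> N" for x K
      proof -
        have "x \<in> K" and kab: "K \<subseteq> {a..b}" using pD(2,3) xK by auto
        moreover obtain u v where k: "K = cbox u v" using pD(4) xK by blast
        ultimately have "u \<le> v" by auto
        then have uv: "u \<in> K" "v \<in> K" by (auto simp: k)
        have ball: "K \<subseteq> ball x (d x)" using fineD[OF fine xK(1)] xK(2) by (simp add: \<gamma>_def)
        have "norm ((v - u) *\<^sub>R f' x - (f v - f u)) = norm (f u - f x - (u - x) *\<^sub>R f' x - (f v - f x - (v - x) *\<^sub>R f' x))"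
          by (auto simp: algebra_simps)
        also have "\<dots> \<le> norm (f u - f x - (u - x) *\<^sub>R f' x) + norm (f v - f x - (v - x) *\<^sub>R f' x)"
          by (rule norm_triangle_ineq4)
        also have "\<dots> \<le> e' * norm (u - x) + e' * norm (v - x)"
          using uv ball \<open>x \<in> K\<close> kab xK by (intro add_mono d) (auto simp: dist_real_def)
        also have "\<dots> = e' * (v - u)"
          using \<open>x \<in> K\<close> by (auto simp: k field_simps)
        finally show ?thesis using \<open>u \<le> v\<close> xK by (simp add: k g_def)
      qed
      have "norm ((\<Sum>(x, K)\<in>p. measure lborel K *\<^sub>R g x) - (f b - f a))
          = norm (\<Sum>(x, K)\<in>p. measure lborel K *\<^sub>R g x - (f (Sup K) - f (Inf K)))"
        by (simp add: fb split_def sum_subtractf)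
      also have "\<dots> \<le> (\<Sum>(x, K)\<in>p. e' * (Sup K - Inf K)
                 + (if x \<in> N then \<bar>f (Sup K) - f (Inf K)\<bar> else 0))"
      proof (rule sum_norm_le, clarify)
        fix x K assume xK: "(x, K) \<in> p"
        have "Inf K \<le> Sup K" 
        proof -
          obtain u v where k: "K = cbox u v" using pD(4) xK by blast
          moreover have "x \<in> K" using pD(2) xK by blast
          ultimately show ?thesis by auto
        qed
        then have "0 \<le> e' * (Sup K - Inf K)" using e' by simp
        then show "norm (measure lborel K *\<^sub>R g x - (f (Sup K) - f (Inf K)))
           \<le> e' * (Sup K - Inf K) + (if x \<in> N then \<bar>f (Sup K) - f (Inf K)\<bar> else 0)"
          using good[OF xK] by (auto simp: g_def abs_minus_commute)
      qed
      also have "\<dots> = e' * (b - a) + (\<Sum>(x, K)\<in>q. \<bar>f (Sup K) - f (Inf K)\<bar>)"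
        unfolding ba q_def
        using fin by (simp add: split_def sum.distrib sum_distrib_left sum.inter_filter)
      also have "\<dots> < e / 2 + e / 2"
      proof (rule add_le_less_mono[OF _ bad])
        have "e' * (b - a) = e / 2 * ((b - a) / (b - a + 1))" by (simp add: e'_def)
        also have "\<dots> \<le> e / 2 * 1" using e0 ab by (intro mult_left_mono) auto
        finally show "e' * (b - a) \<le> e / 2" by simp
      qed
      finally show ?thesis by simp
    qed
    show "\<exists>\<gamma>. gauge \<gamma> \<and> (\<forall>\<D>. \<D> tagged_division_of cbox a b \<and> \<gamma> fine \<D> \<longrightarrow>
        norm ((\<Sum>(x, k)\<in>\<D>. measure lborel k *\<^sub>R g x) - (f b - f a)) < e)"
      by (intro exI[of _ \<gamma>] conjI allI impI gauge) (elim conjE, rule est)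
  qed
  then show ?thesis
    by (rule has_integral_spike[OF N, rotated]) (auto simp: g_def)
qed

text \<open>The fundamental theorem applies to \<open>f * g\<close>, which is absolutely continuous
  because \<open>g\<close> has a bounded derivative and hence is Lipschitz. The term
  \<open>f * g'\<close> is continuous and can be split off, so the gauge integrability of
  \<open>f' * g\<close> is part of the conclusion.\<close>

lemma abs_continuous_integration_by_parts:
  fixes f g f' g' :: "real \<Rightarrow> real"
  assumes ab: "a \<le> b" and f: "abs_continuous_on a b f" and N: "negligible N"
    and f': "\<And>x. x \<in> {a..b} - N \<Longrightarrow> (f has_real_derivative f' x) (at x within {a..b})"
    and g': "\<And>x. x \<in> {a..b} \<Longrightarrow> (g has_real_derivative g' x) (at x within {a..b})"
    and cg': "continuous_on {a..b} g'" and g0: "g a = 0" "g b = 0"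
  shows "((\<lambda>x. f' x * g x) has_integral - integral {a..b} (\<lambda>x. f x * g' x)) {a..b}"
proof -
  obtain B where B: "B > 0" "\<And>x. x \<in> {a..b} \<Longrightarrow> \<bar>g' x\<bar> \<le> B"
    using compact_imp_bounded[OF compact_continuous_image[OF cg' compact_Icc]]
    unfolding bounded_pos by auto
  have "B-lipschitz_on {a..b} g"
  proof (rule lipschitz_onI)
    fix x y assume xy: "x \<in> {a..b}" "y \<in> {a..b}"
    show "dist (g x) (g y) \<le> B * dist x y"
      unfolding dist_norm by (rule field_differentiable_bound[OF _ g']) (use B xy in auto)
  qed (use B in simp)
  then have "abs_continuous_on a b (\<lambda>x. f x * g x)"
    by (rule abs_continuous_on_mult_lipschitz[OF f])
  then have "((\<lambda>x. f' x * g x + f x * g' x) has_integral f b * g b - f a * g a) {a..b}"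
  proof (rule fundamental_theorem_of_calculus_abs_continuous[OF ab _ N])
    fix x assume x: "x \<in> {a..b} - N"
    have "((\<lambda>x. f x * g x) has_real_derivative f' x * g x + g' x * f x) (at x within {a..b})"
      using x by (intro DERIV_mult f' g') auto
    then show "((\<lambda>x. f x * g x) has_vector_derivative f' x * g x + f x * g' x) (at x within {a..b})"
      by (simp add: has_real_derivative_iff_has_vector_derivative mult.commute)
  qed
  moreover have "((\<lambda>x. f x * g' x) has_integral integral {a..b} (\<lambda>x. f x * g' x)) {a..b}"
    by (intro integrable_integral integrable_continuous_real continuous_intros cg'
        abs_continuous_imp_continuous_on[OF f])
  ultimately have "((\<lambda>x. f' x * g x + f x * g' x - f x * g' x)
      has_integral f b * g b - f a * g a - integral {a..b} (\<lambda>x. f x * g' x)) {a..b}"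
    by (rule has_integral_diff)
  then show ?thesis using g0 by simp
qed

section \<open>Convolution with the power kernel\<close>

text \<open>Cutting off both the kernel and the function to \<open>{0..M}\<close> makes the
  Riemann-Liouville integral at points of \<open>{0..M}\<close> a convolution on the whole line, to
  which translation, reflection and Fubini apply.\<close>

definition zero_extension :: "real \<Rightarrow> (real \<Rightarrow> real) \<Rightarrow> real \<Rightarrow> real" where
  "zero_extension M f x = indicator {0..M} x * f x"

section \<open>Measurability, boundedness and integrability of truncated functions\<close>

lemma zero_extension_continuous_measurable:
  assumes "continuous_on {0..M} f"
  shows "zero_extension M f \<in> borel_measurable borel"
  using borel_measurable_continuous_on_indicator[OF _ assms]
  by (simp add: zero_extension_def[abs_def])

lemma zero_extension_continuous_bounded:
  assumes "continuous_on {0..M} f"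
  obtains B where "0 \<le> B" "\<And>x. \<bar>zero_extension M f x\<bar> \<le> B"
proof -
  obtain B where "B > 0" "\<And>x. x \<in> {0..M} \<Longrightarrow> \<bar>f x\<bar> \<le> B"
    using compact_imp_bounded[OF compact_continuous_image[OF assms compact_Icc]]
    unfolding bounded_pos by auto
  then show thesis
    by (intro that[of B]) (auto simp: zero_extension_def indicator_def)
qed

lemma zero_extension_continuous_integrable:
  assumes "continuous_on {0..M} f"
  shows "integrable lborel (zero_extension M f)"
  using borel_integrable_compact[OF compact_Icc assms]
  by (simp add: zero_extension_def[abs_def])

text \<open>The exponent exceeds -1, so a possible singularity at 0 is integrable; nonnegativity
  upgrades gauge to Lebesgue integrability.\<close>

lemma zero_extension_powr_integrable:
  assumes "0 < \<beta>"
  shows "integrable lborel (zero_extension M (\<lambda>s. s powr (\<beta> - 1)))"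
proof (cases "0 \<le> M")
  case True
  have "(\<lambda>s. s powr (\<beta> - 1)) absolutely_integrable_on {0..M}"
    using integrable_on_powr_from_0[of "\<beta> - 1" M] assms True
    by (intro nonnegative_absolutely_integrable_1) auto
  then have "integrable lebesgue (zero_extension M (\<lambda>s. s powr (\<beta> - 1)))"
    by (simp add: set_integrable_def zero_extension_def[abs_def])
  moreover have "zero_extension M (\<lambda>s. s powr (\<beta> - 1)) \<in> borel_measurable lborel"
    unfolding zero_extension_def[abs_def] by measurable
  ultimately show ?thesis by (simp add: integrable_completion)
next
  case False
  then have "zero_extension M (\<lambda>s. s powr (\<beta> - 1)) = (\<lambda>_. 0)" by (auto simp: zero_extension_def)
  then show ?thesis by simp
qed

text \<open>For \<open>x\<close> in \<open>{0..M}\<close> the product of the two indicators is that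
  of \<open>{0..x}\<close>. The first form suits Fubini; the second, obtained by reflection, puts
  the dependence on \<open>x\<close> into \<open>f\<close>, as differentiation requires.\<close>

lemma rl_kernel_integral_eq_convolution:
  assumes x: "0 \<le> x" "x \<le> M" and f: "continuous_on {0..M} f"
  shows "rl_kernel_integral \<beta> f x = (\<integral>\<tau>. zero_extension M (\<lambda>s. s powr (\<beta> - 1)) (x - \<tau>) * zero_extension M f \<tau> \<partial>lborel)"
    and "rl_kernel_integral \<beta> f x = (\<integral>s. zero_extension M (\<lambda>s. s powr (\<beta> - 1)) s * zero_extension M f (x - s) \<partial>lborel)"
proof -
  let ?k = "zero_extension M (\<lambda>s. s powr (\<beta> - 1))"
  have [measurable]: "?k \<in> borel_measurable borel" unfolding zero_extension_def[abs_def] by measurable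
  have [measurable]: "zero_extension M f \<in> borel_measurable borel" by (rule zero_extension_continuous_measurable[OF f])
  have "rl_kernel_integral \<beta> f x = (\<integral>\<tau>. ?k (x - \<tau>) * zero_extension M f \<tau> \<partial>lebesgue)"
    unfolding rl_kernel_integral_def set_lebesgue_integral_def
    using x by (intro Bochner_Integration.integral_cong) (auto simp: zero_extension_def indicator_def)
  also have "\<dots> = (\<integral>\<tau>. ?k (x - \<tau>) * zero_extension M f \<tau> \<partial>lborel)"
    by (rule integral_completion) measurable
  finally show *: "rl_kernel_integral \<beta> f x = (\<integral>\<tau>. ?k (x - \<tau>) * zero_extension M f \<tau> \<partial>lborel)" .
  show "rl_kernel_integral \<beta> f x = (\<integral>s. ?k s * zero_extension M f (x - s) \<partial>lborel)"
    unfolding * by (subst lborel_integral_real_affine[where c="-1" and t=x]) auto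
qed

text \<open>Both sides are the triple convolution of \<open>H\<close>, \<open>k\<close> and
  \<open>U\<close> at \<open>c\<close>. The bound on \<open>H\<close> and the integrability of
  \<open>k\<close> and \<open>U\<close> make the double integral absolutely convergent; after Fubini
  only reflections about \<open>c\<close> remain.\<close>

lemma integral_convolution_swap:
  fixes H k U :: "real \<Rightarrow> real"
  assumes H[measurable]: "H \<in> borel_measurable borel" and B: "\<And>x. \<bar>H x\<bar> \<le> B"
    and k: "integrable lborel k" and U: "integrable lborel U"
  shows "(\<integral>x. H (c - x) * (\<integral>\<tau>. k (x - \<tau>) * U \<tau> \<partial>lborel) \<partial>lborel)
       = (\<integral>y. U (c - y) * (\<integral>s. k (y - s) * H s \<partial>lborel) \<partial>lborel)"
proof -
  have [measurable]: "k \<in> borel_measurable borel" "U \<in> borel_measurable borel"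
    using k U by (auto dest: borel_measurable_integrable)
  have tr: "integrable lborel (\<lambda>x. k (x - \<tau>))" for \<tau>
    using lborel_integrable_real_affine[OF k, of 1 "-\<tau>"] by (simp add: algebra_simps)
  have trn: "(\<integral>x. \<bar>k (x - \<tau>)\<bar> \<partial>lborel) = (\<integral>x. \<bar>k x\<bar> \<partial>lborel)" for \<tau>
    using lborel_integral_real_affine[of 1 "\<lambda>x. \<bar>k x\<bar>" "-\<tau>"] by (simp add: algebra_simps)
  have B0: "0 \<le> B" using B[of 0] by linarith
  \<comment> \<open>By translation invariance the inner integral of the absolute value is
    \<open>\<bar>U \<tau>\<bar>\<close> times the integral of \<open>\<bar>k\<bar>\<close>.\<close>
  have kU: "integrable (lborel \<Otimes>\<^sub>M lborel) (\<lambda>(\<tau>, x). k (x - \<tau>) * U \<tau>)"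
  proof (rule lborel_pair.Fubini_integrable)
    show "(\<lambda>(\<tau>, x). k (x - \<tau>) * U \<tau>) \<in> borel_measurable (lborel \<Otimes>\<^sub>M lborel)"
      by measurable
    show "integrable lborel (\<lambda>\<tau>. \<integral>x. norm (case (\<tau>, x) of (\<tau>, x) \<Rightarrow> k (x - \<tau>) * U \<tau>) \<partial>lborel)"
      using U by (simp add: abs_mult trn)
    show "AE \<tau> in lborel. integrable lborel (\<lambda>x. case (\<tau>, x) of (\<tau>, x) \<Rightarrow> k (x - \<tau>) * U \<tau>)"
      using tr by simp
  qed
  have HkU: "integrable (lborel \<Otimes>\<^sub>M lborel) (\<lambda>(\<tau>, x). H (c - x) * (k (x - \<tau>) * U \<tau>))"
  proof (rule Bochner_Integration.integrable_bound)
    show "integrable (lborel \<Otimes>\<^sub>M lborel) (\<lambda>z. B * (case z of (\<tau>, x) \<Rightarrow> k (x - \<tau>) * U \<tau>))"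
      using kU by simp
    show "(\<lambda>(\<tau>, x). H (c - x) * (k (x - \<tau>) * U \<tau>)) \<in> borel_measurable (lborel \<Otimes>\<^sub>M lborel)"
      by measurable
    show "AE z in lborel \<Otimes>\<^sub>M lborel. norm (case z of (\<tau>, x) \<Rightarrow> H (c - x) * (k (x - \<tau>) * U \<tau>))
        \<le> norm (B * (case z of (\<tau>, x) \<Rightarrow> k (x - \<tau>) * U \<tau>))"
      using B B0 by (intro AE_I2) (auto simp: abs_mult split: prod.split intro!: mult_right_mono)
  qed
  have "(\<integral>x. H (c - x) * (\<integral>\<tau>. k (x - \<tau>) * U \<tau> \<partial>lborel) \<partial>lborel)
      = (\<integral>x. (\<integral>\<tau>. H (c - x) * (k (x - \<tau>) * U \<tau>) \<partial>lborel) \<partial>lborel)"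
    by simp
  also have "\<dots> = (\<integral>\<tau>. (\<integral>x. H (c - x) * (k (x - \<tau>) * U \<tau>) \<partial>lborel) \<partial>lborel)"
    using lborel_pair.Fubini_integral[OF HkU] by simp
  also have "\<dots> = (\<integral>\<tau>. U \<tau> * (\<integral>x. k (x - \<tau>) * H (c - x) \<partial>lborel) \<partial>lborel)"
  proof (rule Bochner_Integration.integral_cong[OF refl])
    fix \<tau>
    have "(\<integral>x. H (c - x) * (k (x - \<tau>) * U \<tau>) \<partial>lborel) = (\<integral>x. U \<tau> * (k (x - \<tau>) * H (c - x)) \<partial>lborel)"
      by (simp add: mult_ac)
    then show "(\<integral>x. H (c - x) * (k (x - \<tau>) * U \<tau>) \<partial>lborel) = U \<tau> * (\<integral>x. k (x - \<tau>) * H (c - x) \<partial>lborel)"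
      by simp
  qed
  also have "\<dots> = (\<integral>\<tau>. U \<tau> * (\<integral>s. k (c - \<tau> - s) * H s \<partial>lborel) \<partial>lborel)"
  proof (rule Bochner_Integration.integral_cong[OF refl])
    fix \<tau>
    have "(\<integral>x. k (x - \<tau>) * H (c - x) \<partial>lborel) = (\<integral>s. k (c - \<tau> - s) * H s \<partial>lborel)"
      by (subst lborel_integral_real_affine[where c="-1" and t=c]) (auto simp: algebra_simps)
    then show "U \<tau> * (\<integral>x. k (x - \<tau>) * H (c - x) \<partial>lborel) = U \<tau> * (\<integral>s. k (c - \<tau> - s) * H s \<partial>lborel)"
      by simp
  qed
  also have "\<dots> = (\<integral>y. U (c - y) * (\<integral>s. k (y - s) * H s \<partial>lborel) \<partial>lborel)"
    by (subst lborel_integral_real_affine[where c="-1" and t=c]) auto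
  finally show ?thesis .
qed

text \<open>The supremum case of Young's inequality, together with the measurability of the
  convolution.\<close>

lemma convolution_bounded:
  fixes H k :: "real \<Rightarrow> real"
  assumes H: "H \<in> borel_measurable borel" and B: "\<And>x. \<bar>H x\<bar> \<le> B"
    and k: "integrable lborel k"
  shows "(\<lambda>y. \<integral>s. k (y - s) * H s \<partial>lborel) \<in> borel_measurable borel"
    and "\<bar>\<integral>s. k (y - s) * H s \<partial>lborel\<bar> \<le> B * (\<integral>s. \<bar>k s\<bar> \<partial>lborel)"
proof -
  note [measurable] = H borel_measurable_integrable[OF k]
  have [measurable]: "k \<in> borel_measurable borel"
    using borel_measurable_integrable[OF k] by simp
  show "(\<lambda>y. \<integral>s. k (y - s) * H s \<partial>lborel) \<in> borel_measurable borel"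
    by measurable
  have tr: "integrable lborel (\<lambda>s. k (y - s))"
    using lborel_integrable_real_affine[OF k, of "-1" y] by simp
  have le: "norm (k (y - s) * H s) \<le> B * \<bar>k (y - s)\<bar>" for s
    using mult_right_mono[OF B[of s] abs_ge_zero[of "k (y - s)"]] by (simp add: abs_mult mult.commute)
  have ib: "integrable lborel (\<lambda>s. B * \<bar>k (y - s)\<bar>)" using tr by simp
  have "norm (\<integral>s. k (y - s) * H s \<partial>lborel) \<le> (\<integral>s. B * \<bar>k (y - s)\<bar> \<partial>lborel)"
  proof (rule Bochner_Integration.integral_norm_bound_integral)
    show "integrable lborel (\<lambda>s. k (y - s) * H s)"
    proof (rule Bochner_Integration.integrable_bound[OF ib])
      show "AE s in lborel. norm (k (y - s) * H s) \<le> norm (B * \<bar>k (y - s)\<bar>)"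
        using le by (intro AE_I2 order_trans[OF le]) simp
    qed measurable
  qed (use ib le in auto)
  also have "\<dots> = B * (\<integral>s. \<bar>k s\<bar> \<partial>lborel)"
    using lborel_integral_real_affine[of "-1" "\<lambda>s. \<bar>k s\<bar>" y] by simp
  finally show "\<bar>\<integral>s. k (y - s) * H s \<partial>lborel\<bar> \<le> B * (\<integral>s. \<bar>k s\<bar> \<partial>lborel)" by simp
qed

text \<open>Since \<open>g 0 = 0\<close>, extending \<open>g\<close> by \<open>0\<close> to the left is Lipschitz, so the difference
  quotients of the convolution are dominated by a multiple of the kernel; the possible kink of
  the extension at \<open>0\<close> only affects a single point of the domain of integration.\<close>

lemma rl_kernel_integral_has_derivative:
  assumes \<beta>: "0 < \<beta>" and x: "x \<in> {0<..<M}" and g0: "g 0 = 0"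
    and g': "\<And>y. y \<in> {0..M} \<Longrightarrow> (g has_real_derivative g' y) (at y within {0..M})"
    and cg': "continuous_on {0..M} g'"
  shows "(rl_kernel_integral \<beta> g has_real_derivative rl_kernel_integral \<beta> g' x) (at x)"
proof -
  let ?k = "zero_extension M (\<lambda>s. s powr (\<beta> - 1))"
  \<comment> \<open>Clamping the argument also extends \<open>g\<close> by the constant
    \<open>g M\<close> on the right, avoiding the jump that \<open>zero_extension\<close> may have
    at \<open>M\<close>.\<close>
  define G where "G y = g (max 0 (min y M))" for y
  have M: "0 < M" using x by auto
  have k: "integrable lborel ?k" by (rule zero_extension_powr_integrable[OF \<beta>])
  have k_meas[measurable]: "?k \<in> borel_measurable borel"
    using k by (auto dest: borel_measurable_integrable)
  have cg: "continuous_on {0..M} g"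
    using g' by (meson DERIV_continuous_on)
  have [measurable]: "zero_extension M g' \<in> borel_measurable borel" by (rule zero_extension_continuous_measurable[OF cg'])
  obtain B where B: "0 \<le> B" "\<And>y. \<bar>zero_extension M g' y\<bar> \<le> B"
    by (rule zero_extension_continuous_bounded[OF cg']) blast
  have lip: "\<bar>g y - g z\<bar> \<le> B * \<bar>y - z\<bar>" if "y \<in> {0..M}" "z \<in> {0..M}" for y z
  proof -
    have "norm (g y - g z) \<le> B * norm (y - z)"
    proof (rule field_differentiable_bound[OF _ g'])
      show "norm (g' y) \<le> B" if "y \<in> {0..M}" for y
        using B(2)[of y] that by (simp add: zero_extension_def)
    qed (use that in auto)
    then show ?thesis by simp
  qed
  have Glip: "\<bar>G y - G z\<bar> \<le> B * \<bar>y - z\<bar>" for y z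
  proof -
    have "\<bar>G y - G z\<bar> \<le> B * \<bar>max 0 (min y M) - max 0 (min z M)\<bar>"
      unfolding G_def using M by (intro lip) auto
    also have "\<dots> \<le> B * \<bar>y - z\<bar>"
      using B(1) by (intro mult_left_mono) auto
    finally show ?thesis .
  qed
  have contG: "continuous_on UNIV G"
    unfolding G_def using M
    by (intro continuous_on_compose2[OF cg] continuous_intros) auto
  then have [measurable]: "G \<in> borel_measurable borel" by (rule borel_measurable_continuous_onI)
  \<comment> \<open>For \<open>s > y\<close> the argument \<open>y - s\<close> is negative and
    \<open>G\<close> vanishes there, so the domain of integration no longer depends on
    \<open>y\<close>.\<close>
  have eqG: "rl_kernel_integral \<beta> g y = (\<integral>s. ?k s * G (y - s) \<partial>lborel)" if y: "y \<in> {0..M}" for y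
  proof -
    have eq: "?k s * zero_extension M g (y - s) = ?k s * G (y - s)" for s
    proof (cases "s \<in> {0..M}")
      case s: True
      then have "zero_extension M g (y - s) = G (y - s)"
      proof (cases "s \<le> y")
        case True
        then have "y - s \<in> {0..M}" using s y by simp
        then show ?thesis by (simp add: zero_extension_def G_def)
      next
        case False
        then have "y - s \<notin> {0..M}" "max 0 (min (y - s) M) = 0" using M by auto
        then show ?thesis using g0 by (simp add: zero_extension_def G_def)
      qed
      then show ?thesis by simp
    qed (simp add: zero_extension_def)
    have "rl_kernel_integral \<beta> g y = (\<integral>s. ?k s * zero_extension M g (y - s) \<partial>lborel)"
      using y by (intro rl_kernel_integral_eq_convolution(2) cg) auto
    then show ?thesis by (simp only: eq)
  qed
  have Gbd: "\<bar>G y\<bar> \<le> B * M" for y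
  proof -
    define z where "z = max 0 (min y M)"
    have z: "z \<in> {0..M}" using M by (auto simp: z_def)
    have "\<bar>g z - g 0\<bar> \<le> B * \<bar>z - 0\<bar>" using z M by (intro lip) auto
    also have "\<dots> \<le> B * M" using B(1) z by (intro mult_left_mono) auto
    finally show ?thesis using g0 by (simp add: G_def z_def)
  qed
  have int: "integrable lborel (\<lambda>s. ?k s * G (y - s))" for y
  proof (rule Bochner_Integration.integrable_bound)
    show "integrable lborel (\<lambda>s. ?k s * (B * M))" using k by simp
    show "AE s in lborel. norm (?k s * G (y - s)) \<le> norm (?k s * (B * M))"
      using Gbd B M by (intro AE_I2) (auto simp: abs_mult intro!: mult_left_mono)
  qed measurable
  have Gder: "(G has_real_derivative zero_extension M g' z) (at z)" if z: "z < M" "z \<noteq> 0" for z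
  proof (cases "z < 0")
    case True
    have "((\<lambda>_. 0) has_real_derivative zero_extension M g' z) (at z)"
      using True by (auto simp: zero_extension_def intro!: derivative_eq_intros)
    then show ?thesis
    proof (rule has_field_derivative_transform_within_open[where S="{..<0}"])
      show "0 = G y" if "y \<in> {..<0}" for y using that M g0 by (simp add: G_def min_def max_def)
    qed (use True in auto)
  next
    case False
    then have zz: "z \<in> {0<..<M}" using z by auto
    have "(g has_real_derivative g' z) (at z)"
      using g'[of z] zz at_within_Icc_at[of 0 z M] by auto
    then have "(g has_real_derivative zero_extension M g' z) (at z)"
      using zz by (simp add: zero_extension_def)
    then show ?thesis
    proof (rule has_field_derivative_transform_within_open[where S="{0<..<M}"])
      show "g y = G y" if "y \<in> {0<..<M}" for y using that by (simp add: G_def min_def max_def)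
    qed (use zz in auto)
  qed
  \<comment> \<open>The limit of the difference quotients is taken along sequences to make dominated
    convergence applicable.\<close>
  have "((\<lambda>y. (rl_kernel_integral \<beta> g y - rl_kernel_integral \<beta> g x) / (y - x))
      \<longlongrightarrow> rl_kernel_integral \<beta> g' x) (at x within {0<..<M})"
    unfolding tendsto_at_iff_sequentially
  proof (intro allI impI)
    fix X :: "nat \<Rightarrow> real"
    assume X: "\<forall>i. X i \<in> {0<..<M} - {x}" "X \<longlonglongrightarrow> x"
    have Xf: "filterlim X (at x) sequentially"
      using X by (auto simp: filterlim_at)
    have q: "(rl_kernel_integral \<beta> g (X i) - rl_kernel_integral \<beta> g x) / (X i - x)
        = (\<integral>s. ?k s * ((G (X i - s) - G (x - s)) / (X i - x)) \<partial>lborel)" for i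
    proof -
      have "X i \<in> {0..M}" "x \<in> {0..M}" using X x by (auto simp: less_imp_le)
      then have "(rl_kernel_integral \<beta> g (X i) - rl_kernel_integral \<beta> g x) / (X i - x)
        = (\<integral>s. (?k s * G (X i - s) - ?k s * G (x - s)) / (X i - x) \<partial>lborel)"
        by (simp add: eqG int)
      then show ?thesis by (simp add: algebra_simps)
    qed
    have lim: "(\<lambda>i. \<integral>s. ?k s * ((G (X i - s) - G (x - s)) / (X i - x)) \<partial>lborel)
        \<longlonglongrightarrow> (\<integral>s. ?k s * zero_extension M g' (x - s) \<partial>lborel)"
    proof (rule integral_dominated_convergence)
      show "integrable lborel (\<lambda>s. \<bar>?k s\<bar> * B)" using k by simp
      show "AE s in lborel. norm (?k s * ((G (X i - s) - G (x - s)) / (X i - x))) \<le> \<bar>?k s\<bar> * B" for i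
      proof (intro AE_I2)
        fix s
        have "X i \<noteq> x" using X by auto
        then have "\<bar>(G (X i - s) - G (x - s)) / (X i - x)\<bar> \<le> B"
          using Glip[of "X i - s" "x - s"] by (simp add: divide_le_eq)
        then show "norm (?k s * ((G (X i - s) - G (x - s)) / (X i - x))) \<le> \<bar>?k s\<bar> * B"
          by (simp only: real_norm_def abs_mult) (rule mult_left_mono, auto)
      qed
      have "(\<lambda>i. ?k s * ((G (X i - s) - G (x - s)) / (X i - x))) \<longlonglongrightarrow> ?k s * zero_extension M g' (x - s)"
        if s: "s \<noteq> x" for s
      proof (cases "s \<in> {0..M}")
        case True
        have "(G has_real_derivative zero_extension M g' (x - s)) (at (x - s))"
          using True s x by (intro Gder) auto
        then have "((\<lambda>y. (G (y - s) - G (x - s)) / (y - x)) \<longlongrightarrow> zero_extension M g' (x - s)) (at x)"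
          using DERIV_shift[of G "zero_extension M g' (x - s)" x "-s"] 
          by (simp add: has_field_derivative_iff)
        from filterlim_compose[OF this Xf] show ?thesis
          by (intro tendsto_mult_left)
      next
        case False
        then show ?thesis by (simp add: zero_extension_def)
      qed
      moreover have "AE s in lborel. s \<noteq> x" by (rule AE_lborel_singleton)
      ultimately show "AE s in lborel. (\<lambda>i. ?k s * ((G (X i - s) - G (x - s)) / (X i - x)))
          \<longlonglongrightarrow> ?k s * zero_extension M g' (x - s)" by auto
    qed measurable
    then show "((\<lambda>y. (rl_kernel_integral \<beta> g y - rl_kernel_integral \<beta> g x) / (y - x)) \<circ> X)
        \<longlonglongrightarrow> rl_kernel_integral \<beta> g' x"
      unfolding o_def q using x by (subst rl_kernel_integral_eq_convolution(2)[OF _ _ cg']) auto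
  qed
  then show ?thesis
    using at_within_open[OF x open_greaterThanLessThan] by (simp only: has_field_derivative_iff)
qed

text \<open>With the reflection \<open>M - x\<close>, both integrals are the value at
  \<open>M\<close> of the convolution of the kernel, \<open>u\<close> and \<open>f\<close>, so
  Fubini identifies them. Integrability holds because a bounded convolution is multiplied by an
  integrable function.\<close>

lemma rl_kernel_integral_adjoint:
  assumes \<beta>: "0 < \<beta>" and u: "continuous_on {0..M} u" and f: "continuous_on {0..M} f"
  shows "(\<lambda>x. rl_kernel_integral \<beta> f x * u (M - x)) absolutely_integrable_on {0..M}" (is ?int)
    and "(LINT x:{0..M}|lebesgue. rl_kernel_integral \<beta> u x * f (M - x))
       = (LINT x:{0..M}|lebesgue. rl_kernel_integral \<beta> f x * u (M - x))" (is ?eq)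
proof -
  let ?k = "zero_extension M (\<lambda>s. s powr (\<beta> - 1))"
  have k: "integrable lborel ?k" by (rule zero_extension_powr_integrable[OF \<beta>])
  note meas = zero_extension_continuous_measurable
  have conv: "indicator {0..M} x *\<^sub>R (rl_kernel_integral \<beta> g x * h (M - x))
      = zero_extension M h (M - x) * (\<integral>\<tau>. ?k (x - \<tau>) * zero_extension M g \<tau> \<partial>lborel)"
    if "continuous_on {0..M} g" for g h x
  proof (cases "x \<in> {0..M}")
    case True
    then show ?thesis
      by (simp add: rl_kernel_integral_eq_convolution(1)[OF _ _ that] zero_extension_def)
  next
    case False
    then show ?thesis by (auto simp: zero_extension_def indicator_def)
  qed
  have meas_prod: "(\<lambda>x. zero_extension M h (M - x) * (\<integral>\<tau>. ?k (x - \<tau>) * zero_extension M g \<tau> \<partial>lborel)) \<in> borel_measurable borel"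
    if g: "continuous_on {0..M} g" and h: "continuous_on {0..M} h" for g h
  proof -
    obtain B where "\<And>x. \<bar>zero_extension M g x\<bar> \<le> B" by (rule zero_extension_continuous_bounded[OF g]) blast
    note [measurable] = convolution_bounded(1)[OF meas[OF g] this k] meas[OF h]
    show ?thesis by measurable
  qed
  obtain B where B: "\<And>x. \<bar>zero_extension M f x\<bar> \<le> B" by (rule zero_extension_continuous_bounded[OF f]) blast
  have "integrable lborel (\<lambda>x. zero_extension M u (M - x) * (\<integral>\<tau>. ?k (x - \<tau>) * zero_extension M f \<tau> \<partial>lborel))"
  proof (rule Bochner_Integration.integrable_bound)
    show "integrable lborel (\<lambda>x. zero_extension M u (M - x) * (B * (\<integral>s. \<bar>?k s\<bar> \<partial>lborel)))"
      using lborel_integrable_real_affine[OF zero_extension_continuous_integrable[OF u], of "-1" M] by simp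
    show "AE x in lborel. norm (zero_extension M u (M - x) * (\<integral>\<tau>. ?k (x - \<tau>) * zero_extension M f \<tau> \<partial>lborel))
        \<le> norm (zero_extension M u (M - x) * (B * (\<integral>s. \<bar>?k s\<bar> \<partial>lborel)))"
      using order_trans[OF convolution_bounded(2)[OF meas[OF f] B k] abs_ge_self]
      by (intro AE_I2) (simp only: real_norm_def abs_mult mult_left_mono abs_ge_zero)
  qed (use meas_prod[OF f u] in simp)
  then show ?int
    unfolding set_integrable_def conv[OF f] using meas_prod[OF f u] by (simp add: integrable_completion)
  have leb: "(LINT x:{0..M}|lebesgue. rl_kernel_integral \<beta> g x * h (M - x))
      = (\<integral>x. zero_extension M h (M - x) * (\<integral>\<tau>. ?k (x - \<tau>) * zero_extension M g \<tau> \<partial>lborel) \<partial>lborel)"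
    if "continuous_on {0..M} g" "continuous_on {0..M} h" for g h
    unfolding set_lebesgue_integral_def conv[OF that(1)]
    using meas_prod[OF that] by (intro integral_completion) simp
  show ?eq
    unfolding leb[OF u f] leb[OF f u]
    by (rule integral_convolution_swap[OF meas[OF f] B k zero_extension_continuous_integrable[OF u]])
qed

section \<open>Modulating functions\<close>

lemma times_differentiable_on_imp_has_real_derivative:
  assumes "times_differentiable_on k S f" "i < k" "x \<in> S"
  shows "(nth_deriv_on S i f has_real_derivative nth_deriv_on S (Suc i) f x) (at x within S)"
  using assms
  by (simp add: times_differentiable_on_def differentiable_on_def
      vector_derivative_works has_real_derivative_iff_has_vector_derivative)

lemma times_differentiable_on_imp_continuous_on:
  assumes "times_differentiable_on k S f" "i < k"
  shows "continuous_on S (nth_deriv_on S i f)"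
  using assms by (simp add: times_differentiable_on_def differentiable_imp_continuous_on)

lemma Ck_on_imp_continuous_on:
  assumes "Ck_on k S f" "i \<le> k"
  shows "continuous_on S (nth_deriv_on S i f)"
  using assms times_differentiable_on_imp_continuous_on
  by (cases "i = k") (auto simp: Ck_on_def)

lemma has_real_derivative_Icc_imp_at:
  fixes f :: "real \<Rightarrow> real"
  assumes "(f has_real_derivative D) (at x within {a..b})" "x \<in> {a<..<b}"
  shows "(f has_real_derivative D) (at x)"
  using assms at_within_Icc_at[of a x b] by simp

lemma has_real_derivative_cong_on_interval:
  fixes g h :: "real \<Rightarrow> real"
  assumes g: "(g has_real_derivative D) (at x)" and x: "x \<in> {a<..<b}"
    and eq: "\<And>y. y \<in> {a<..<b} \<Longrightarrow> h y = g y"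
  shows "(h has_real_derivative D) (at x)"
  by (rule has_field_derivative_transform_within_open[OF g, of "{a<..<b}"]) (use x eq in auto)

text \<open>Derivatives within \<open>{a..b}\<close> and two-sided ones agree at interior points.
  The next derivative needs this agreement on a whole neighbourhood, hence the induction for all
  interior \<open>x\<close> at once. The factor \<open>C\<close> is meant for the Gamma value
  between \<open>rl_kernel_integral\<close> and \<open>rl_integral\<close>.\<close>

lemma deriv_funpow_eq_nth_deriv_on:
  assumes f: "times_differentiable_on k {a..b} f" and i: "i \<le> k" and x: "x \<in> {a<..<b}"
  shows "(deriv ^^ i) (\<lambda>x. C * f x) x = C * nth_deriv_on {a..b} i f x"
  using i x
proof (induction i arbitrary: x)
  case (Suc i)
  have "((\<lambda>x. C * nth_deriv_on {a..b} i f x) has_real_derivative C * nth_deriv_on {a..b} (Suc i) f x) (at x)"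
    using Suc.prems
    by (intro DERIV_cmult has_real_derivative_Icc_imp_at[OF times_differentiable_on_imp_has_real_derivative[OF f]]) auto
  then have "((deriv ^^ i) (\<lambda>x. C * f x) has_real_derivative C * nth_deriv_on {a..b} (Suc i) f x) (at x)"
    by (rule has_real_derivative_cong_on_interval[OF _ Suc.prems(2)]) (use Suc in simp)
  then show ?case
    by (simp del: nth_deriv_on.simps add: DERIV_imp_deriv)
qed simp

text \<open>The derivatives of \<open>\<phi>\<close> of order below \<open>p\<close> vanish at 0, so
  each differentiation passes through the kernel without a boundary term. For \<open>i = p\<close>
  this computes the Riemann-Liouville derivative of \<open>\<phi>\<close> up to the Gamma
  factor.\<close>

lemma deriv_funpow_rl_kernel_integral:
  assumes \<beta>: "0 < \<beta>" and \<phi>: "modulating_function p 0 M \<phi>" and i: "i \<le> p" and x: "x \<in> {0<..<M}"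
  shows "(deriv ^^ i) (rl_kernel_integral \<beta> \<phi>) x = rl_kernel_integral \<beta> (nth_deriv_on {0..M} i \<phi>) x"
  using i x
proof (induction i arbitrary: x)
  case (Suc i)
  have C: "Ck_on p {0..M} \<phi>" "times_differentiable_on p {0..M} \<phi>" "nth_deriv_on {0..M} i \<phi> 0 = 0"
    using \<phi> Suc.prems by (auto simp: modulating_function_def Ck_on_def)
  have "(rl_kernel_integral \<beta> (nth_deriv_on {0..M} i \<phi>) has_real_derivative
      rl_kernel_integral \<beta> (nth_deriv_on {0..M} (Suc i) \<phi>) x) (at x)"
    using Suc.prems C
    by (intro rl_kernel_integral_has_derivative[OF \<beta>, where M=M] times_differentiable_on_imp_has_real_derivative[of p]
        Ck_on_imp_continuous_on) auto
  then have "((deriv ^^ i) (rl_kernel_integral \<beta> \<phi>) has_real_derivative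
      rl_kernel_integral \<beta> (nth_deriv_on {0..M} (Suc i) \<phi>) x) (at x)"
    by (rule has_real_derivative_cong_on_interval[OF _ Suc.prems(2)]) (use Suc in simp)
  then show ?case
    by (simp del: nth_deriv_on.simps add: DERIV_imp_deriv)
qed simp

section \<open>Reflection and repeated integration by parts\<close>

lemma has_real_derivative_reflect:
  fixes f :: "real \<Rightarrow> real"
  assumes "(f has_real_derivative D) (at (b - x) within {0..b})"
  shows "((\<lambda>x. f (b - x)) has_real_derivative - D) (at x within {0..b})"
proof -
  have "((\<lambda>x. b - x) has_real_derivative - 1) (at x within {0..b})"
    by (auto intro!: derivative_eq_intros)
  moreover have "(f has_real_derivative D) (at (b - x) within (\<lambda>x. b - x) ` {0..b})"
    using assms by simp
  ultimately show ?thesis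
    using DERIV_image_chain[of f D "\<lambda>x. b - x" x "{0..b}" "-1"] by (simp add: o_def)
qed

lemma continuous_on_reflect:
  fixes f :: "real \<Rightarrow> real"
  assumes "continuous_on {0..b} f"
  shows "continuous_on {0..b} (\<lambda>x. f (b - x))"
  by (rule continuous_on_compose2[OF assms]) (auto intro!: continuous_intros)

lemma modulating_function_reflect_derivative:
  assumes \<phi>: "modulating_function p 0 M \<phi>" and i: "i < p" and x: "x \<in> {0..M}"
  shows "((\<lambda>x. nth_deriv_on {0..M} i \<phi> (M - x)) has_real_derivative
      - nth_deriv_on {0..M} (Suc i) \<phi> (M - x)) (at x within {0..M})"
  using \<phi> x unfolding modulating_function_def Ck_on_def
  by (intro has_real_derivative_reflect times_differentiable_on_imp_has_real_derivative[OF _ i]) auto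

text \<open>One derivative at a time moves between \<open>F\<close> and the reflected
  \<open>\<phi>\<close>. The minus sign of each integration by parts cancels that of the reflection,
  and the boundary terms vanish because they contain only derivatives of \<open>\<phi>\<close> of
  order below \<open>p\<close>.\<close>

lemma modulating_function_integration_by_parts:
  assumes \<phi>: "modulating_function p 0 M \<phi>" and M: "0 \<le> M" "M \<le> L"
    and F: "times_differentiable_on k {0..L} F"
    and Fk: "continuous_on {0..L} (nth_deriv_on {0..L} k F)"
    and j: "j \<le> k" "j \<le> p"
  shows "integral {0..M} (\<lambda>x. nth_deriv_on {0..L} j F x * nth_deriv_on {0..M} (p - j) \<phi> (M - x))
       = integral {0..M} (\<lambda>x. F x * nth_deriv_on {0..M} p \<phi> (M - x))"
  using j
proof (induction j)
  case (Suc j)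
  define A where "A = nth_deriv_on {0..L} j F"
  define A' where "A' = nth_deriv_on {0..L} (Suc j) F"
  define q where "q = p - Suc j"
  have q: "q < p" "p - j = Suc q" using Suc.prems by (auto simp: q_def)
  define \<psi> where "\<psi> = (\<lambda>x. nth_deriv_on {0..M} q \<phi> (M - x))"
  define \<psi>' where "\<psi>' = (\<lambda>x. nth_deriv_on {0..M} (Suc q) \<phi> (M - x))"
  have sub: "{0..M} \<subseteq> {0..L}" using M by auto
  have cF: "continuous_on {0..M} (nth_deriv_on {0..L} i F)" if "i \<le> k" for i
    using that Fk times_differentiable_on_imp_continuous_on[OF F, of i]
    by (cases "i = k") (auto intro: continuous_on_subset[OF _ sub])
  have c\<phi>: "continuous_on {0..M} (\<lambda>x. nth_deriv_on {0..M} i \<phi> (M - x))" if "i \<le> p" for i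
    using \<phi> that unfolding modulating_function_def
    by (intro continuous_on_reflect Ck_on_imp_continuous_on[of p]) auto
  have cont: "continuous_on {0..M} A" "continuous_on {0..M} A'" "continuous_on {0..M} \<psi>" "continuous_on {0..M} \<psi>'"
    unfolding A_def A'_def \<psi>_def \<psi>'_def using Suc.prems q by (intro cF c\<phi>; simp)+
  have der: "((\<lambda>x. A x * \<psi> x) has_real_derivative A' x * \<psi> x + - \<psi>' x * A x) (at x within {0..M})"
    if x: "x \<in> {0..M}" for x
  proof (rule DERIV_mult)
    have "(A has_real_derivative A' x) (at x within {0..L})"
      unfolding A_def A'_def using Suc.prems x sub
      by (intro times_differentiable_on_imp_has_real_derivative[OF F]) auto
    then show "(A has_real_derivative A' x) (at x within {0..M})"
      by (rule DERIV_subset[OF _ sub])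
    show "(\<psi> has_real_derivative - \<psi>' x) (at x within {0..M})"
      unfolding \<psi>_def \<psi>'_def by (rule modulating_function_reflect_derivative[OF \<phi> q(1) x])
  qed
  have "((\<lambda>x. A' x * \<psi> x + - \<psi>' x * A x) has_integral A M * \<psi> M - A 0 * \<psi> 0) {0..M}"
    using der M(1) by (intro fundamental_theorem_of_calculus)
      (auto simp: has_real_derivative_iff_has_vector_derivative)
  moreover have "\<psi> 0 = 0" "\<psi> M = 0"
    using \<phi> q by (auto simp: \<psi>_def modulating_function_def)
  ultimately have "integral {0..M} (\<lambda>x. A' x * \<psi> x - A x * \<psi>' x) = 0"
    by (simp add: integral_unique mult.commute)
  moreover have "integral {0..M} (\<lambda>x. A' x * \<psi> x - A x * \<psi>' x)
      = integral {0..M} (\<lambda>x. A' x * \<psi> x) - integral {0..M} (\<lambda>x. A x * \<psi>' x)"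
    by (intro Henstock_Kurzweil_Integration.integral_diff integrable_continuous_real continuous_intros cont)
  moreover have "integral {0..M} (\<lambda>x. A x * \<psi>' x) = integral {0..M} (\<lambda>x. F x * nth_deriv_on {0..M} p \<phi> (M - x))"
    using Suc.IH Suc.prems unfolding A_def \<psi>'_def q by simp
  ultimately show ?case
    unfolding A_def A'_def \<psi>_def \<psi>'_def q_def by simp
qed simp

text \<open>Made for the coefficients, whose integrands contain two-sided derivatives that are
  meaningful only off the end points: the integrand is replaced off a null set, and the Lebesgue
  integral becomes a gauge integral.\<close>

lemma set_lebesgue_integral_spike:
  fixes f g :: "real \<Rightarrow> real"
  assumes "f absolutely_integrable_on S" "negligible N" "\<And>x. x \<in> S - N \<Longrightarrow> g x = f x"
  shows "(LINT x:S|lebesgue. g x) = integral S f"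
proof -
  have "g absolutely_integrable_on S"
    by (rule absolutely_integrable_spike[OF assms])
  then have "(LINT x:S|lebesgue. g x) = integral S g"
    by (rule set_lebesgue_integral_eq_integral(2))
  also have "\<dots> = integral S f"
    by (rule integral_spike[OF assms(2)]) (use assms(3) in auto)
  finally show ?thesis .
qed

section \<open>The linear system\<close>

text \<open>On the open interval the inner derivatives in \<open>rl_derivative\<close> are those
  taken within \<open>{0..L}\<close>. Where the outermost one exists, the fractional derivative is
  thus an ordinary derivative of a function covered by the regularity convention.\<close>

lemma has_real_derivative_rl_derivative:
  assumes p: "rl_order \<alpha> = Suc k" and \<beta>: "\<beta> = real (Suc k) - \<alpha>" "0 < \<beta>"
    and u: "times_differentiable_on k {0..L} (rl_integral \<beta> u)" and x: "x \<in> {0<..<L}"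
    and d: "rl_differentiable_at \<alpha> u x"
  shows "(nth_deriv_on {0..L} k (rl_integral \<beta> u) has_real_derivative rl_derivative \<alpha> u x) (at x)"
proof -
  define K where "K = rl_kernel_integral \<beta> u"
  have G: "Gamma \<beta> \<noteq> 0" using \<beta>(2) Gamma_real_pos[of \<beta>] by linarith
  then have K: "K = (\<lambda>x. Gamma \<beta> * rl_integral \<beta> u x)"
    by (auto simp: K_def rl_integral_def)
  have "((deriv ^^ k) K has_real_derivative deriv ((deriv ^^ k) K) x) (at x)"
    using d by (simp add: rl_differentiable_at_def p K_def \<beta> DERIV_deriv_iff_real_differentiable)
  then have "((\<lambda>y. 1 / Gamma \<beta> * (deriv ^^ k) K y) has_real_derivative 1 / Gamma \<beta> * deriv ((deriv ^^ k) K) x) (at x)"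
    by (rule DERIV_cmult)
  moreover have "rl_derivative \<alpha> u x = 1 / Gamma \<beta> * deriv ((deriv ^^ k) K) x"
    by (simp add: rl_derivative_def p K_def \<beta>)
  ultimately have "((\<lambda>y. 1 / Gamma \<beta> * (deriv ^^ k) K y) has_real_derivative rl_derivative \<alpha> u x) (at x)"
    by (simp only:)
  then show ?thesis
  proof (rule has_real_derivative_cong_on_interval[OF _ x])
    fix y assume "y \<in> {0<..<L}"
    then have "(deriv ^^ k) K y = Gamma \<beta> * nth_deriv_on {0..L} k (rl_integral \<beta> u) y"
      unfolding K by (rule deriv_funpow_eq_nth_deriv_on[OF u order_refl])
    then show "nth_deriv_on {0..L} k (rl_integral \<beta> u) y = 1 / Gamma \<beta> * (deriv ^^ k) K y"
      using G by simp
  qed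
qed

text \<open>The first two coefficients are brought to a common form, the integral of
  \<open>f x * \<phi>n 1 (L\<^sub>1 - x)\<close> with \<open>f\<close> absolutely continuous:
  \<open>f = u\<close> for the first, \<open>f = J\<close> for the second. One integration by parts
  then serves both, and the equation combines the results.\<close>

lemma coefficient_equation:
  assumes L: "0 < L\<^sub>1" "L\<^sub>1 \<le> L" and \<alpha>: "1 < \<alpha>"
    and sol: "solution L \<alpha> \<nu> d r g\<^sub>0 c"
    and p: "real p - 1 \<le> \<alpha>" "\<alpha> < real p"
    and \<phi>: "modulating_function p 0 L\<^sub>1 \<phi>"
    and t: "0 < t"
  shows "coeff_A L\<^sub>1 \<phi> c t * - \<nu> + coeff_B L\<^sub>1 \<alpha> \<phi> c t * d = coeff_C L\<^sub>1 \<phi> r c t"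
proof -
  define u where "u = (\<lambda>x. c x t)"
  define \<beta> where "\<beta> = real p - \<alpha>"
  obtain k where k: "p = Suc k" using \<alpha> p by (cases p) auto
  \<comment> \<open>Hence at least one derivative of \<open>I\<close> exists, which makes
    \<open>I\<close> continuous.\<close>
  have "k \<ge> 1" using k \<alpha> p by linarith
  have ord: "rl_order \<alpha> = p" using rl_order_iff[of \<alpha> p] \<alpha> p k by simp
  have \<beta>: "0 < \<beta>" "\<beta> = real (Suc k) - \<alpha>" using p k by (auto simp: \<beta>_def)
  define I where "I = rl_integral \<beta> u"
  define J where "J = nth_deriv_on {0..L} k I"
  have reg: "abs_continuous_on 0 L u" "times_differentiable_on k {0..L} I" "abs_continuous_on 0 L J"
    "set_integrable lebesgue {0<..<L} (\<lambda>x. deriv (\<lambda>s. c x s) t)"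
    "set_integrable lebesgue {0<..<L} (\<lambda>x. r x t)"
    using sol t unfolding solution_def regular_enough_def J_def I_def u_def \<beta>_def ord by (simp_all add: k)
  have sub: "{0..L\<^sub>1} \<subseteq> {0..L}" using L by auto
  have cJ: "continuous_on {0..L} J" by (rule abs_continuous_imp_continuous_on[OF reg(3)])
  have cu: "continuous_on {0..L\<^sub>1} u"
    by (rule continuous_on_subset[OF abs_continuous_imp_continuous_on[OF reg(1)] sub])
  have cI: "continuous_on {0..L\<^sub>1} I"
    using times_differentiable_on_imp_continuous_on[OF reg(2), of 0] \<open>k \<ge> 1\<close>
    by (auto intro: continuous_on_subset[OF _ sub])
  define \<phi>n where "\<phi>n i = nth_deriv_on {0..L\<^sub>1} i \<phi>" for i
  have c\<phi>: "continuous_on {0..L\<^sub>1} (\<phi>n i)" if "i \<le> p" for i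
    using \<phi> that unfolding modulating_function_def \<phi>n_def by (intro Ck_on_imp_continuous_on[of p]) auto
  have c\<phi>r: "continuous_on {0..L\<^sub>1} (\<lambda>x. \<phi>n i (L\<^sub>1 - x))" if "i \<le> p" for i
    using c\<phi>[OF that] by (rule continuous_on_reflect)
  define \<psi> where "\<psi> = (\<lambda>x. \<phi> (L\<^sub>1 - x))"
  have c\<psi>: "continuous_on {0..L\<^sub>1} \<psi>" using c\<phi>r[of 0] by (simp add: \<phi>n_def \<psi>_def)
  have \<psi>': "(\<psi> has_real_derivative - \<phi>n 1 (L\<^sub>1 - x)) (at x within {0..L\<^sub>1})" if "x \<in> {0..L\<^sub>1}" for x
    using modulating_function_reflect_derivative[OF \<phi> _ that, of 0] k by (simp add: \<psi>_def \<phi>n_def)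
  have \<psi>0: "\<psi> 0 = 0" "\<psi> L\<^sub>1 = 0"
    using \<phi> k by (auto simp: \<psi>_def modulating_function_def)

  have "AE x in lebesgue. x \<in> {0<..<L} \<longrightarrow> equation_holds_at \<alpha> \<nu> d r c x t"
    using sol t by (simp add: solution_def)
  then obtain N\<^sub>0 where N0: "\<And>x. x \<in> space lebesgue - N\<^sub>0 \<Longrightarrow> x \<in> {0<..<L} \<longrightarrow> equation_holds_at \<alpha> \<nu> d r c x t"
      "N\<^sub>0 \<in> null_sets lebesgue"
    by (rule AE_E3) blast
  \<comment> \<open>Removing the end points leaves only points interior to both intervals, where
    two-sided derivatives are meaningful.\<close>
  define N where "N = N\<^sub>0 \<union> {0, L\<^sub>1}"
  have N: "negligible N"
    unfolding N_def using N0(2) by (simp add: negligible_iff_null_sets negligible_Un)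
  have eq: "equation_holds_at \<alpha> \<nu> d r c x t" and int: "x \<in> {0<..<L}" "x \<in> {0<..<L\<^sub>1}"
    if x: "x \<in> {0..L\<^sub>1} - N" for x
  proof -
    show "x \<in> {0<..<L\<^sub>1}" using x by (auto simp: N_def order_less_le)
    then show "x \<in> {0<..<L}" using L by auto
    then show "equation_holds_at \<alpha> \<nu> d r c x t" using x N0(1)[of x] by (simp add: N_def)
  qed
  have fin: "negligible {0, L\<^sub>1}" by (intro negligible_finite) auto

  have A: "coeff_A L\<^sub>1 \<phi> c t = integral {0..L\<^sub>1} (\<lambda>x. u x * \<phi>n 1 (L\<^sub>1 - x))"
    unfolding coeff_A_def
  proof (rule set_lebesgue_integral_spike[OF _ fin])
    show "(\<lambda>x. u x * \<phi>n 1 (L\<^sub>1 - x)) absolutely_integrable_on {0..L\<^sub>1}"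
      using k by (intro absolutely_integrable_continuous_real continuous_intros cu c\<phi>r) simp
    fix x assume "x \<in> {0..L\<^sub>1} - {0, L\<^sub>1}"
    then have x: "L\<^sub>1 - x \<in> {0<..<L\<^sub>1}" by auto
    have "(\<phi> has_real_derivative \<phi>n 1 (L\<^sub>1 - x)) (at (L\<^sub>1 - x))"
      using times_differentiable_on_imp_has_real_derivative[of p "{0..L\<^sub>1}" \<phi> 0 "L\<^sub>1 - x"] \<phi> k x
      by (intro has_real_derivative_Icc_imp_at[OF _ x]) (auto simp: \<phi>n_def modulating_function_def Ck_on_def)
    then show "deriv \<phi> (L\<^sub>1 - x) * c x t = u x * \<phi>n 1 (L\<^sub>1 - x)"
      by (simp add: DERIV_imp_deriv u_def)
  qed

  \<comment> \<open>The fractional derivative of \<open>\<phi>\<close> is the kernel integral of its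
    \<open>p\<close>-th derivative. The chain below transfers the kernel to \<open>u\<close> and
    then \<open>k\<close> derivatives from \<open>\<phi>\<close> to \<open>I\<close>.\<close>
  have "coeff_B L\<^sub>1 \<alpha> \<phi> c t = integral {0..L\<^sub>1} (\<lambda>x. 1 / Gamma \<beta> * (rl_kernel_integral \<beta> (\<phi>n p) x * u (L\<^sub>1 - x)))"
    unfolding coeff_B_def
  proof (rule set_lebesgue_integral_spike[OF _ fin])
    show "(\<lambda>x. 1 / Gamma \<beta> * (rl_kernel_integral \<beta> (\<phi>n p) x * u (L\<^sub>1 - x))) absolutely_integrable_on {0..L\<^sub>1}"
      by (intro set_integrable_mult_right impI rl_kernel_integral_adjoint(1) \<beta> cu c\<phi>) simp
    fix x assume "x \<in> {0..L\<^sub>1} - {0, L\<^sub>1}"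
    then have x: "x \<in> {0<..<L\<^sub>1}" by auto
    show "rl_derivative \<alpha> \<phi> x * c (L\<^sub>1 - x) t = 1 / Gamma \<beta> * (rl_kernel_integral \<beta> (\<phi>n p) x * u (L\<^sub>1 - x))"
      using deriv_funpow_rl_kernel_integral[OF \<beta>(1) \<phi> order_refl x]
      by (simp add: rl_derivative_def ord \<phi>n_def u_def \<beta>_def)
  qed
  also have "\<dots> = 1 / Gamma \<beta> * (LINT x:{0..L\<^sub>1}|lebesgue. rl_kernel_integral \<beta> (\<phi>n p) x * u (L\<^sub>1 - x))"
    using set_lebesgue_integral_eq_integral(2)[OF rl_kernel_integral_adjoint(1)[OF \<beta>(1) cu c\<phi>[OF order_refl]]]
    by simp
  also have "\<dots> = 1 / Gamma \<beta> * (LINT x:{0..L\<^sub>1}|lebesgue. rl_kernel_integral \<beta> u x * \<phi>n p (L\<^sub>1 - x))"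
    by (simp add: rl_kernel_integral_adjoint(2)[OF \<beta>(1) cu c\<phi>[OF order_refl]])
  also have "\<dots> = (LINT x:{0..L\<^sub>1}|lebesgue. I x * \<phi>n p (L\<^sub>1 - x))"
    by (simp add: I_def rl_integral_def flip: set_integral_mult_right)
  also have "\<dots> = integral {0..L\<^sub>1} (\<lambda>x. I x * \<phi>n p (L\<^sub>1 - x))"
    by (intro set_lebesgue_integral_eq_integral(2) absolutely_integrable_continuous_real
        continuous_intros cI c\<phi>r order_refl)
  \<comment> \<open>Here \<open>j = k\<close> and \<open>p - k = 1\<close>. The last derivative is
    left for \<open>parts\<close>, since \<open>J\<close> is only known to be absolutely
    continuous.\<close>
  also have "\<dots> = integral {0..L\<^sub>1} (\<lambda>x. J x * \<phi>n 1 (L\<^sub>1 - x))"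
    using modulating_function_integration_by_parts[OF \<phi> _ L(2) reg(2) cJ[unfolded J_def], of k] L(1) k
    by (simp add: J_def \<phi>n_def)
  finally have B: "coeff_B L\<^sub>1 \<alpha> \<phi> c t = integral {0..L\<^sub>1} (\<lambda>x. J x * \<phi>n 1 (L\<^sub>1 - x))" .

  \<comment> \<open>The derivative of \<open>\<psi>\<close> carries a minus sign from the
    reflection, which cancels the one from integration by parts.\<close>
  have parts: "((\<lambda>x. f' x * \<psi> x) has_integral integral {0..L\<^sub>1} (\<lambda>x. f x * \<phi>n 1 (L\<^sub>1 - x))) {0..L\<^sub>1}"
    if f: "abs_continuous_on 0 L f" and f': "\<And>x. x \<in> {0..L\<^sub>1} - N \<Longrightarrow> (f has_real_derivative f' x) (at x)" for f f'
  proof -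
    have "((\<lambda>x. f' x * \<psi> x) has_integral - integral {0..L\<^sub>1} (\<lambda>x. f x * - \<phi>n 1 (L\<^sub>1 - x))) {0..L\<^sub>1}"
    proof (rule abs_continuous_integration_by_parts[OF _ abs_continuous_on_subinterval[OF f sub] N _ \<psi>'])
      show "(f has_real_derivative f' x) (at x within {0..L\<^sub>1})" if "x \<in> {0..L\<^sub>1} - N" for x
        using f'[OF that] by (rule has_field_derivative_at_within)
      show "continuous_on {0..L\<^sub>1} (\<lambda>x. - \<phi>n 1 (L\<^sub>1 - x))"
        using k by (intro continuous_intros c\<phi>r) simp
    qed (use L \<psi>0 in auto)
    then show ?thesis by simp
  qed
  have I1: "((\<lambda>x. deriv u x * \<psi> x) has_integral coeff_A L\<^sub>1 \<phi> c t) {0..L\<^sub>1}"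
    unfolding A using eq by (intro parts reg)
      (simp add: equation_holds_at_def u_def DERIV_deriv_iff_real_differentiable)
  have I2: "((\<lambda>x. rl_derivative \<alpha> u x * \<psi> x) has_integral coeff_B L\<^sub>1 \<alpha> \<phi> c t) {0..L\<^sub>1}"
    unfolding B
  proof (intro parts reg)
    fix x assume x: "x \<in> {0..L\<^sub>1} - N"
    show "(J has_real_derivative rl_derivative \<alpha> u x) (at x)"
      unfolding J_def I_def using eq[OF x]
      by (intro has_real_derivative_rl_derivative \<beta> int[OF x] reg(2)[unfolded I_def])
        (simp_all add: ord k equation_holds_at_def u_def)
  qed
  define W where "W = (\<lambda>x. deriv (\<lambda>s. c x s) t - r x t)"
  have I12: "((\<lambda>x. - \<nu> * (deriv u x * \<psi> x) + d * (rl_derivative \<alpha> u x * \<psi> x)) has_integral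
      - \<nu> * coeff_A L\<^sub>1 \<phi> c t + d * coeff_B L\<^sub>1 \<alpha> \<phi> c t) {0..L\<^sub>1}"
    by (intro has_integral_add has_integral_mult_right I1 I2)
  \<comment> \<open>Off \<open>N\<close> the equation identifies \<open>W\<close> with the
    combination of the two spatial terms.\<close>
  have "((\<lambda>x. \<psi> x * W x) has_integral - \<nu> * coeff_A L\<^sub>1 \<phi> c t + d * coeff_B L\<^sub>1 \<alpha> \<phi> c t) {0..L\<^sub>1}"
  proof (rule has_integral_spike[OF N _ I12])
    fix x assume "x \<in> {0..L\<^sub>1} - N"
    from eq[OF this] have W: "W x = - \<nu> * deriv u x + d * rl_derivative \<alpha> u x"
      by (simp add: equation_holds_at_def W_def u_def)
    show "\<psi> x * W x = - \<nu> * (deriv u x * \<psi> x) + d * (rl_derivative \<alpha> u x * \<psi> x)"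
      by (simp add: W algebra_simps)
  qed
  \<comment> \<open>Since \<open>W\<close> is integrable by the regularity convention and
    \<open>\<psi>\<close> is bounded, the Lebesgue integral in \<open>coeff_C\<close> equals the
    gauge integral just computed.\<close>
  moreover have "(\<lambda>x. \<psi> x * W x) absolutely_integrable_on {0..L\<^sub>1}"
  proof (rule absolutely_integrable_bounded_measurable_product_real)
    show "\<psi> \<in> borel_measurable (lebesgue_on {0..L\<^sub>1})"
      using c\<psi> by (rule continuous_imp_measurable_on_sets_lebesgue) simp
    show "bounded (\<psi> ` {0..L\<^sub>1})"
      by (rule compact_imp_bounded[OF compact_continuous_image[OF c\<psi> compact_Icc]])
    have "set_integrable lebesgue {0<..<L} W"
      unfolding W_def using reg(4,5) by (rule set_integral_diff(1))
    then have "W absolutely_integrable_on {0<..<L\<^sub>1}"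
      by (rule set_integrable_subset) (use L in auto)
    then show "W absolutely_integrable_on {0..L\<^sub>1}"
      by (rule absolutely_integrable_spike_set_eq[THEN iffD1, rotated -1])
        (rule negligible_subset[OF fin], force)+
  qed simp
  ultimately have "(LINT x:{0..L\<^sub>1}|lebesgue. \<psi> x * W x) = - \<nu> * coeff_A L\<^sub>1 \<phi> c t + d * coeff_B L\<^sub>1 \<alpha> \<phi> c t"
    by (simp add: set_lebesgue_integral_eq_integral(2) integral_unique)
  moreover have "coeff_C L\<^sub>1 \<phi> r c t = (LINT x:{0..L\<^sub>1}|lebesgue. \<psi> x * W x)"
    by (simp add: coeff_C_def \<psi>_def W_def algebra_simps)
  ultimately show ?thesis by (simp add: mult.commute)
qed

theorem theorem4p1:
  fixes L L\<^sub>1 \<alpha> \<nu> d :: real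
    and c r :: "real \<Rightarrow> real \<Rightarrow> real" and g\<^sub>0 :: "real \<Rightarrow> real"
    and p :: nat
    and \<phi> :: "'n::finite \<Rightarrow> real \<Rightarrow> real"
  assumes "L > 0" and "0 < L\<^sub>1" and "L\<^sub>1 \<le> L"
    and "1 < \<alpha>" and "\<alpha> \<le> 2"
    and "solution L \<alpha> \<nu> d r g\<^sub>0 c"
    and "0 < p" and "real p - 1 \<le> \<alpha>" and "\<alpha> < real p"
    and "CARD('n) \<ge> 2"
    and "\<And>n. modulating_function p 0 L\<^sub>1 (\<phi> n)"
  shows "\<forall>t>0.
    (\<chi> n. vector [coeff_A L\<^sub>1 (\<phi> n) c t, coeff_B L\<^sub>1 \<alpha> (\<phi> n) c t] :: real ^ 2 ^ 'n)
      *v vector [- \<nu>, d] = (\<chi> n. coeff_C L\<^sub>1 (\<phi> n) r c t)"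
proof (intro allI impI)
  fix t :: real assume "0 < t"
  then have "coeff_A L\<^sub>1 (\<phi> n) c t * - \<nu> + coeff_B L\<^sub>1 \<alpha> (\<phi> n) c t * d = coeff_C L\<^sub>1 (\<phi> n) r c t" for n
    by (rule coefficient_equation[OF assms(2,3,4,6,8,9,11)])
  then show "(\<chi> n. vector [coeff_A L\<^sub>1 (\<phi> n) c t, coeff_B L\<^sub>1 \<alpha> (\<phi> n) c t] :: real ^ 2 ^ 'n)
      *v vector [- \<nu>, d] = (\<chi> n. coeff_C L\<^sub>1 (\<phi> n) r c t)"
    by (simp add: vec_eq_iff matrix_vector_mult_def sum_2)
qed

end
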